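(* Let $X=(X_1,\dots,X_p)$ be a random vector, let $Y=f(X)$ be square-integrable with $\mathrm{Var}(Y)\neq 0$, and let $\mathcal{C}=\{C_1,\dots,C_k\}$ be a partition of $[1:p]$ such that the groups of random variables $A_1=X_{C_1},\dots,A_k=X_{C_k}$ are independent. Write $Y=g(A_1,\dots,A_k)$ with Hoeffding decomposition $g(A)=\sum_{w\subseteq[1:k]}g_w(A_w)$. Then for all $u\subseteq[1:p]$, the Sobol index $S_u$ of $Y$ satisfies $$S_u=\sum_{\substack{w\subseteq[1:k],\\ u\subseteq C_w}}S_w^g\,S_u^{g,w},$$ where $C_w=\bigcup_{j\in w}C_j$, $S_w^g$ is the Sobol index of $g$ for the group of inputs $A_w$, and $S_u^{g,w}$ is the Sobol index of $g_w(A_w)$ for the group of inputs $X_u$.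
   Context: Let $(\Omega,\mathcal{A},\mathbb{P})$ be a probability space, let $E=\times_{i=1}^pE_i$ be a product of measurable spaces $(E_i,\mathcal{E}_i)$ with the product $\sigma$-algebra $\mathcal{E}=\otimes_{i=1}^p\mathcal{E}_i$, and let $X=(X_1,\dots,X_p):\Omega\to E$ be a random variable. Let $f:(E,\mathcal{E})\to(\mathbb{R},\mathcal{B}(\mathbb{R}))$ be measurable with $f(X)\in L^2$; $Y:=f(X)$, and $\mathrm{Var}(Y)\neq0$ is assumed. $[1:p]$ is the set of integers from $1$ to $p$, and $|u|$ is the cardinality of $u$. For $u\subseteq[1:p]$, $x_u:=(x_i)_{i\in u}$; conditioning on $X_\emptyset$ is trivial conditioning, i.e. $\mathrm{E}(\cdot\mid X_\emptyset)=\mathrm{E}(\cdot)$. Put $V_u:=\mathrm{Var}(\mathrm{E}(Y\mid X_u))$. The Sobol indices of $Y$ are $$S_u:=\frac{1}{\mathrm{Var}(Y)}\sum_{v\subseteq u}(-1)^{|u|-|v|}V_v,\qquad u\subseteq[1:p].$$ The (nonempty, disjoint) sets $C_1,\dots,C_k$ partition $[1:p]$; $A_j:=X_{C_j}$, $A:=(A_1,\dots,A_k)$, and for $w\subseteq[1:k]$, $A_w:=(A_j)_{j\in w}$. The function $g$ is $f$ viewed as a function of the groups: $f(X_1,\dots,X_p)=g(A_1,\dots,A_k)$. The Hoeffding decomposition of $g$ is the (almost surely unique) decomposition $g(A)=\sum_{w\subseteq[1:k]}g_w(A_w)$ with $g_w(A_w)\in L^2$ and $\mathrm{E}(g_w(A_w)\mid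 A_z)=0$ for every $z\subseteq[1:k]$ with $w\not\subseteq z$ (so $g_\emptyset=\mathrm{E}(Y)$). By convention $C_\emptyset=\emptyset$. The Sobol indices of $g$ are $$S_w^g:=\frac{\mathrm{Var}(g_w(A_w))}{\mathrm{Var}(Y)}=\frac{1}{\mathrm{Var}(Y)}\sum_{z\subseteq w}(-1)^{|w|-|z|}V_z^g,\qquad V_z^g:=\mathrm{Var}(\mathrm{E}(Y\mid A_z)).$$ Put $V_u^{g,w}:=\mathrm{Var}(\mathrm{E}(g_w(A_w)\mid X_u))$, and for $u\subseteq C_w$, $$S_u^{g,w}:=\frac{1}{\mathrm{Var}(g_w(A_w))}\sum_{v\subseteq u}(-1)^{|u|-|v|}V_v^{g,w}.$$ Convention: when $\mathrm{Var}(g_w(A_w))=0$ (so that $S_w^g=0$ and $S_u^{g,w}$ is not defined), the product $S_w^gS_u^{g,w}$ is taken to be $0$. *)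

theory Defs
  imports "HOL-Probability.Probability"
begin

definition subvec :: "('i \<Rightarrow> 'a \<Rightarrow> 'b) \<Rightarrow> 'i set \<Rightarrow> 'a \<Rightarrow> 'i \<Rightarrow> 'b" where
  "subvec X u \<omega> = (\<lambda>i\<in>u. X i \<omega>)"

(* E(Z | X_u), with the i-th coordinate X i taking values in the measurable space E i.
   For u = {} the generated sigma-algebra is trivial. *)
definition cond_exp_given ::
  "'a measure \<Rightarrow> ('i \<Rightarrow> 'b measure) \<Rightarrow> ('i \<Rightarrow> 'a \<Rightarrow> 'b) \<Rightarrow> 'i set \<Rightarrow> ('a \<Rightarrow> real) \<Rightarrow> 'a \<Rightarrow> real" where
  "cond_exp_given M E X u Z =
     real_cond_exp M (vimage_algebra (space M) (subvec X u) (Pi\<^sub>M u E)) Z"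

definition explained_variance ::
  "'a measure \<Rightarrow> ('i \<Rightarrow> 'b measure) \<Rightarrow> ('i \<Rightarrow> 'a \<Rightarrow> 'b) \<Rightarrow> ('a \<Rightarrow> real) \<Rightarrow> 'i set \<Rightarrow> real" where
  "explained_variance M E X Z u = prob_space.variance M (cond_exp_given M E X u Z)"

(* If Z has variance zero, the index is 0 because 1 / 0 = 0; a product with such an
   undefined index is therefore 0. *)
definition sobol_index ::
  "'a measure \<Rightarrow> ('i \<Rightarrow> 'b measure) \<Rightarrow> ('i \<Rightarrow> 'a \<Rightarrow> 'b) \<Rightarrow> ('a \<Rightarrow> real) \<Rightarrow> 'i set \<Rightarrow> real" where
  "sobol_index M E X Z u =
     1 / prob_space.variance M Z *
     (\<Sum>v\<in>Pow u. (-1) ^ (card u - card v) * explained_variance M E X Z v)"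

(* A function f of (x_i), i in I, read as a function of the groups (a_j), j in J, where
   a_j = (x_i), i in C j, and the sets C j partition I. *)
definition regroup ::
  "'i set \<Rightarrow> 'j set \<Rightarrow> ('j \<Rightarrow> 'i set) \<Rightarrow> (('i \<Rightarrow> 'b) \<Rightarrow> real) \<Rightarrow> ('j \<Rightarrow> 'i \<Rightarrow> 'b) \<Rightarrow> real" where
  "regroup I J C f a = f (\<lambda>i\<in>I. a (THE j. j \<in> J \<and> i \<in> C j) i)"

definition hoeffding_decomposition ::
  "'a measure \<Rightarrow> 'j set \<Rightarrow> ('j \<Rightarrow> 'b measure) \<Rightarrow> ('j \<Rightarrow> 'a \<Rightarrow> 'b) \<Rightarrow>
   (('j \<Rightarrow> 'b) \<Rightarrow> real) \<Rightarrow> ('j set \<Rightarrow> ('j \<Rightarrow> 'b) \<Rightarrow> real) \<Rightarrow> bool" where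
  "hoeffding_decomposition M J B A g h \<longleftrightarrow>
     (\<forall>w\<subseteq>J. h w \<in> borel_measurable (Pi\<^sub>M w B)
        \<and> integrable M (\<lambda>\<omega>. (h w (subvec A w \<omega>))\<^sup>2)
        \<and> (\<forall>z\<subseteq>J. \<not> w \<subseteq> z \<longrightarrow>
             (AE \<omega> in M. cond_exp_given M B A z (\<lambda>\<omega>. h w (subvec A w \<omega>)) \<omega> = 0)))
     \<and> (AE \<omega> in M. g (subvec A J \<omega>) = (\<Sum>w\<in>Pow J. h w (subvec A w \<omega>)))"

end

theory Submission
  imports Defs
begin

text \<open>
  Write \<open>Z w\<close> for the Hoeffding component of the group set \<open>w\<close>, so that \<open>Y\<close> is the sum of all \<open>Z w\<close>, and
  \<open>C w\<close> for the union of the \<open>C j\<close> with \<open>j \<in> w\<close>. The heart of the matter is that the decomposition of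
  the variance of \<open>Y\<close> survives conditioning on an arbitrary subvector \<open>X v\<close>, even one that cuts
  through the groups and whose members are dependent:
  \<open>Var (E (Y | X v)) = (\<Sum>w. Var (E (Z w | X v)))\<close>.

  The reason is that \<open>Z w\<close> depends only on groups that are independent of all the others, hence
  \<open>E (Z w | X v) = E (Z w | X (v \<inter> C w))\<close> (\<open>projection_eq_on_members\<close>). This projection is therefore a
  function of the groups in \<open>w\<close>, and a component \<open>Z w'\<close> with \<open>w'\<close> not contained in \<open>w\<close> is orthogonal
  to every square-integrable function of these groups by the defining property of the Hoeffding decomposition. Of two distinct
  sets of groups one is not contained in the other, so the projections of distinct components are
  uncorrelated (\<open>projections_uncorrelated\<close>).

  The Sobol index of \<open>Y\<close> for \<open>u\<close> is thus a sum over \<open>w\<close> of alternating sums of \<open>Var (E (Z w | X v))\<close>,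
  \<open>v \<subseteq> u\<close>. If \<open>u\<close> has a member \<open>i\<close> outside \<open>C w\<close>, the summand does not change when \<open>i\<close> is added to \<open>v\<close>
  and the alternating sum vanishes (\<open>alternating_sum_eq_0\<close>). For the other \<open>w\<close> it is \<open>Var (Z w)\<close>
  times the Sobol index of \<open>Z w\<close>, and Moebius inversion of the same variance decomposition, read at
  \<open>v = C z\<close>, identifies \<open>Var (Z w)\<close> with \<open>Var Y\<close> times the Sobol index of the group set \<open>w\<close>
  (\<open>sobol_index_groups\<close>).
\<close>

section \<open>Alternating sums over subsets\<close>

text \<open>The subsets of \<open>u\<close> come in pairs \<open>v\<close>, \<open>insert i v\<close> whose terms have opposite signs.\<close>

lemma alternating_sum_eq_0:
  fixes a :: "'i set \<Rightarrow> real"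
  assumes "finite u" "i \<in> u" and a: "\<And>v. v \<subseteq> u - {i} \<Longrightarrow> a (insert i v) = a v"
  shows "(\<Sum>v\<in>Pow u. (-1) ^ (card u - card v) * a v) = 0"
proof -
  define u' where "u' = u - {i}"
  have u': "finite u'" "i \<notin> u'" "u = insert i u'"
    using assms by (auto simp: u'_def)
  have inj: "inj_on (insert i) (Pow u')"
    using u'(2) by (intro inj_onI) (metis Pow_iff insert_ident subsetD)
  have "(\<Sum>v\<in>Pow u. (-1) ^ (card u - card v) * a v) =
      (\<Sum>v\<in>Pow u'. (-1) ^ (card u - card v) * a v)
      + (\<Sum>v\<in>insert i ` Pow u'. (-1) ^ (card u - card v) * a v)"
    unfolding u'(3) Pow_insert using u' by (intro sum.union_disjoint) auto
  also have "(\<Sum>v\<in>insert i ` Pow u'. (-1) ^ (card u - card v) * a v) =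
      (\<Sum>v\<in>Pow u'. - ((-1) ^ (card u - card v) * a v))"
    unfolding sum.reindex[OF inj]
  proof (intro sum.cong refl)
    fix v assume "v \<in> Pow u'"
    then have v: "v \<subseteq> u'" by simp
    then have fin: "finite v" and i: "i \<notin> v" and le: "card v \<le> card u'"
      using u' by (auto intro: finite_subset card_mono)
    have "a (insert i v) = a v"
      using v by (intro a) (simp add: u'_def)
    moreover have "card u = Suc (card u')" "card (insert i v) = Suc (card v)"
      using u' fin i by simp_all
    ultimately show "((\<lambda>v. (-1) ^ (card u - card v) * a v) \<circ> insert i) v =
        - ((-1) ^ (card u - card v) * a v)"
      using le by (simp add: Suc_diff_le)
  qed
  finally show ?thesis
    by (simp add: sum_negf)
qed

text \<open>Moebius inversion on the subset lattice. Each \<open>a y\<close> enters with the weight \<open>y \<subseteq> z\<close>, a function of \<open>z\<close>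
  that ignores every \<open>i \<in> w - y\<close>; so \<open>alternating_sum_eq_0\<close> removes all \<open>y\<close> other than \<open>w\<close>.\<close>

lemma alternating_sum_of_subset_sums:
  fixes a :: "'i set \<Rightarrow> real"
  assumes "finite w"
  shows "(\<Sum>z\<in>Pow w. (-1) ^ (card w - card z) * (\<Sum>y\<in>Pow z. a y)) = a w"
proof -
  have "(\<Sum>z\<in>Pow w. (-1) ^ (card w - card z) * (\<Sum>y\<in>Pow z. a y)) =
      (\<Sum>z\<in>Pow w. \<Sum>y\<in>Pow w. (-1) ^ (card w - card z) * (of_bool (y \<subseteq> z) * a y))"
  proof (intro sum.cong refl)
    fix z assume "z \<in> Pow w"
    then have "(\<Sum>y\<in>Pow z. a y) = (\<Sum>y\<in>Pow w. of_bool (y \<subseteq> z) * a y)"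
      using assms by (intro sum.mono_neutral_cong_left) auto
    then show "(-1) ^ (card w - card z) * (\<Sum>y\<in>Pow z. a y) =
        (\<Sum>y\<in>Pow w. (-1) ^ (card w - card z) * (of_bool (y \<subseteq> z) * a y))"
      by (simp add: sum_distrib_left)
  qed
  also have "\<dots> = (\<Sum>y\<in>Pow w. \<Sum>z\<in>Pow w. (-1) ^ (card w - card z) * (of_bool (y \<subseteq> z) * a y))"
    by (rule sum.swap)
  also have "\<dots> = (\<Sum>y\<in>{w}. \<Sum>z\<in>Pow w. (-1) ^ (card w - card z) * (of_bool (y \<subseteq> z) * a y))"
  proof (intro sum.mono_neutral_right ballI)
    fix y assume "y \<in> Pow w - {w}"
    then obtain i where "i \<in> w" "i \<notin> y" by blast
    then show "(\<Sum>z\<in>Pow w. (-1) ^ (card w - card z) * (of_bool (y \<subseteq> z) * a y)) = 0"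
      using assms by (intro alternating_sum_eq_0[of w i]) (auto simp: subset_insert)
  qed (use assms in auto)
  also have "\<dots> = (\<Sum>z\<in>Pow w. (-1) ^ (card w - card z) * (of_bool (w \<subseteq> z) * a w))"
    by simp
  also have "\<dots> = (\<Sum>z\<in>{w}. (-1) ^ (card w - card z) * (of_bool (w \<subseteq> z) * a w))"
    using assms by (intro sum.mono_neutral_right) auto
  finally show ?thesis by simp
qed

section \<open>Variance and conditional expectation\<close>

lemma integrable_mult_of_squares:
  fixes S T :: "'a \<Rightarrow> real"
  assumes [measurable]: "S \<in> borel_measurable M" "T \<in> borel_measurable M"
    and "integrable M (\<lambda>x. (S x)\<^sup>2)" "integrable M (\<lambda>x. (T x)\<^sup>2)"
  shows "integrable M (\<lambda>x. S x * T x)"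
proof (rule Bochner_Integration.integrable_bound)
  show "integrable M (\<lambda>x. (S x)\<^sup>2 + (T x)\<^sup>2)"
    using assms by simp
  have "\<bar>S x * T x\<bar> \<le> (S x)\<^sup>2 + (T x)\<^sup>2" for x
  proof -
    have "2 * \<bar>S x * T x\<bar> \<le> (S x)\<^sup>2 + (T x)\<^sup>2"
      using sum_squares_bound[of "\<bar>S x\<bar>" "\<bar>T x\<bar>"] by (simp add: abs_mult)
    then show ?thesis
      using abs_ge_zero[of "S x * T x"] by linarith
  qed
  then show "AE x in M. norm (S x * T x) \<le> norm ((S x)\<^sup>2 + (T x)\<^sup>2)"
    by (auto intro: order_trans[OF _ abs_ge_self])
qed simp

lemma (in prob_space) variance_sum_uncorrelated:
  fixes T :: "'i \<Rightarrow> 'a \<Rightarrow> real"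
  assumes I: "finite I"
    and T: "\<And>i. i \<in> I \<Longrightarrow> T i \<in> borel_measurable M" "\<And>i. i \<in> I \<Longrightarrow> integrable M (\<lambda>x. (T i x)\<^sup>2)"
    and uncorrelated: "\<And>i j. i \<in> I \<Longrightarrow> j \<in> I \<Longrightarrow> i \<noteq> j \<Longrightarrow>
      expectation (\<lambda>x. T i x * T j x) = expectation (T i) * expectation (T j)"
  shows "variance (\<lambda>x. \<Sum>i\<in>I. T i x) = (\<Sum>i\<in>I. variance (T i))"
proof -
  have int: "integrable M (T i)" if "i \<in> I" for i
    using square_integrable_imp_integrable T that by blast
  have int2: "integrable M (\<lambda>x. T i x * T j x)" if "i \<in> I" "j \<in> I" for i j
    using integrable_mult_of_squares T that by blast
  have sq: "(\<Sum>i\<in>I. T i x)\<^sup>2 = (\<Sum>i\<in>I. \<Sum>j\<in>I. T i x * T j x)" for x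
    by (simp add: power2_eq_square sum_product)
  have "variance (\<lambda>x. \<Sum>i\<in>I. T i x) =
      expectation (\<lambda>x. (\<Sum>i\<in>I. T i x)\<^sup>2) - (expectation (\<lambda>x. \<Sum>i\<in>I. T i x))\<^sup>2"
    using int int2 by (intro variance_eq) (auto simp: sq)
  also have "\<dots> = (\<Sum>i\<in>I. \<Sum>j\<in>I. expectation (\<lambda>x. T i x * T j x) - expectation (T i) * expectation (T j))"
    using int int2 by (simp add: sq power2_eq_square sum_product sum_subtractf)
  also have "\<dots> = (\<Sum>i\<in>I. \<Sum>j\<in>I. if i = j then variance (T i) else 0)"
  proof (intro sum.cong refl)
    fix i j assume "i \<in> I" "j \<in> I"
    then show "expectation (\<lambda>x. T i x * T j x) - expectation (T i) * expectation (T j) =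
        (if i = j then variance (T i) else 0)"
      using variance_eq[of "T i"] int T(2) uncorrelated[of i j] by (auto simp: power2_eq_square)
  qed
  finally show ?thesis
    using I by simp
qed

text \<open>This lets two generating families of one sigma-algebra be exchanged as an equation, not merely
  almost everywhere.\<close>

lemma real_cond_exp_cong_sets:
  assumes "sets F = sets G"
  shows "real_cond_exp M F Z = real_cond_exp M G Z"
  using assms sets_eq_imp_space_eq[OF assms]
  by (simp add: real_cond_exp_def nn_cond_exp_def restr_to_subalg_def subalgebra_def)

text \<open>The version of \<open>real_cond_exp_sum\<close> for families that are integrable only on the index set, as the
  components of a Hoeffding decomposition are.\<close>

lemma (in sigma_finite_subalgebra) real_cond_exp_sum_finite:
  fixes f :: "'i \<Rightarrow> 'a \<Rightarrow> real"
  assumes "\<And>i. i \<in> I \<Longrightarrow> integrable M (f i)"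
  shows "AE x in M. real_cond_exp M F (\<lambda>x. \<Sum>i\<in>I. f i x) x = (\<Sum>i\<in>I. real_cond_exp M F (f i) x)"
proof -
  have "AE x in M. real_cond_exp M F (\<lambda>x. \<Sum>i\<in>I. (if i \<in> I then f i else (\<lambda>_. 0)) x) x =
      (\<Sum>i\<in>I. real_cond_exp M F (if i \<in> I then f i else (\<lambda>_. 0)) x)"
    using assms by (intro real_cond_exp_sum) simp
  then show ?thesis by (simp cong: sum.cong)
qed

lemma (in finite_measure_subalgebra) real_cond_exp_square_integrable:
  assumes "Z \<in> borel_measurable M" "integrable M (\<lambda>x. (Z x)\<^sup>2)"
  shows "integrable M (\<lambda>x. (real_cond_exp M F Z x)\<^sup>2)"
proof (rule integrable_convex_cond_exp[where I = UNIV and q = "\<lambda>x. x\<^sup>2" and X = Z])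
  show "convex_on UNIV (\<lambda>x::real. x\<^sup>2)"
    by (rule convex_power2)
qed (use assms square_integrable_imp_integrable emeasure_finite in auto)

lemma (in prob_space) finite_measure_subalgebraI:
  "subalgebra M F \<Longrightarrow> finite_measure_subalgebra M F"
  by unfold_locales

lemma (in prob_space) variance_cong_AE:
  assumes "S \<in> borel_measurable M" "T \<in> borel_measurable M" "AE x in M. S x = (T x :: real)"
  shows "variance S = variance T"
proof -
  have "expectation S = expectation T"
    using assms by (intro integral_cong_AE) auto
  then show ?thesis
    using assms by (intro integral_cong_AE) auto
qed

text \<open>A variable without variance is almost surely constant. This settles the components for which the
  quotient defining the Sobol index degenerates.\<close>

lemma (in prob_space) variance_cond_exp_eq_0:
  assumes F: "subalgebra M F"
    and Z: "Z \<in> borel_measurable M" "integrable M (\<lambda>x. (Z x)\<^sup>2)"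
    and var: "variance Z = 0"
  shows "variance (real_cond_exp M F Z) = 0"
proof -
  interpret F: finite_measure_subalgebra M F
    using F by (rule finite_measure_subalgebraI)
  have int: "integrable M Z"
    using Z by (rule square_integrable_imp_integrable)
  have "integrable M (\<lambda>x. (Z x - expectation Z)\<^sup>2)"
    using int Z by (simp add: power2_diff)
  then have "AE x in M. (Z x - expectation Z)\<^sup>2 = 0"
    using var by (subst (asm) integral_nonneg_eq_0_iff_AE) auto
  then have "AE x in M. Z x = expectation Z"
    by simp
  then have "AE x in M. real_cond_exp M F Z x = real_cond_exp M F (\<lambda>_. expectation Z) x"
    using Z by (intro F.real_cond_exp_cong) auto
  moreover have "AE x in M. real_cond_exp M F (\<lambda>_. expectation Z) x = expectation Z"
    by (intro F.real_cond_exp_F_meas) auto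
  ultimately have "AE x in M. real_cond_exp M F Z x = expectation Z"
    by (rule eventually_elim2) simp
  then have "variance (real_cond_exp M F Z) = variance (\<lambda>_. expectation Z)"
    by (intro variance_cong_AE) auto
  then show ?thesis by (simp add: prob_space)
qed

text \<open>Conditioning on additional independent information changes nothing: if \<open>Z\<close> and \<open>G\<close> live in \<open>F\<close>, and
  \<open>K\<close> enlarges \<open>G\<close> by events of some \<open>H\<close> independent of \<open>F\<close>, then \<open>K\<close> predicts \<open>Z\<close> no better than \<open>G\<close>.
  With the residual \<open>D = Z - E (Z | G)\<close>, independence gives \<open>E (1_(a \<inter> b) D) = E (1_a D) P(b) = 0\<close> for
  \<open>a \<in> G\<close> and \<open>b \<in> H\<close>. These intersections are stable under intersection and generate a
  sigma-algebra containing \<open>K\<close>, so \<open>D\<close> integrates to zero over every event of \<open>K\<close>, which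
  characterises the conditional expectation given \<open>K\<close>.\<close>

lemma (in prob_space) real_cond_exp_join_indep:
  assumes F: "subalgebra M F" and H: "subalgebra M H" and K: "subalgebra M K"
    and GF: "subalgebra F G" and GK: "subalgebra K G"
    and gen: "sets K \<subseteq> sigma_sets (space M) {a \<inter> b | a b. a \<in> sets G \<and> b \<in> sets H}"
    and indep: "indep_set (sets F) (sets H)"
    and Z: "integrable M Z" "Z \<in> borel_measurable F"
  shows "AE x in M. real_cond_exp M K Z x = real_cond_exp M G Z x"
proof -
  have G: "subalgebra M G"
    using F GF by (auto simp: subalgebra_def)
  interpret G: finite_measure_subalgebra M G
    using G by (rule finite_measure_subalgebraI)
  interpret K: finite_measure_subalgebra M K
    using K by (rule finite_measure_subalgebraI)
  let ?P = "{a \<inter> b | a b. a \<in> sets G \<and> b \<in> sets H}"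
  define D where "D x = Z x - real_cond_exp M G Z x" for x
  have int_R: "integrable M (real_cond_exp M G Z)"
    using Z(1) by (rule G.real_cond_exp_int)
  have int_D: "integrable M D"
    unfolding D_def using Z(1) int_R by simp
  have D_F: "D \<in> borel_measurable F"
    unfolding D_def
    using Z(2) measurable_from_subalg[OF GF borel_measurable_cond_exp] by simp
  have int_ind: "integrable M (\<lambda>x. indicator a x * f x)"
    if "a \<in> sets M" "integrable M f" for a and f :: "'a \<Rightarrow> real"
    using integrable_mult_indicator[OF that] by simp
  have P_M: "?P \<subseteq> sets M"
    using G H by (auto simp: subalgebra_def)
  have sigma_M: "sigma_sets (space M) ?P \<subseteq> sets M"
    using P_M by (rule sets.sigma_sets_subset)
  have zero: "(\<integral>x. indicator a x * D x \<partial>M) = 0" if "a \<in> sets G" for a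
  proof -
    have a_M: "a \<in> sets M"
      using that G by (auto simp: subalgebra_def)
    have "(\<integral>x. indicator a x * Z x \<partial>M) = (\<integral>x. indicator a x * real_cond_exp M G Z x \<partial>M)"
      using G.real_cond_exp_intA[OF Z(1) that] by (simp add: set_lebesgue_integral_def)
    then show ?thesis
      using int_ind[OF a_M Z(1)] int_ind[OF a_M int_R]
      by (simp add: D_def right_diff_distrib)
  qed
  have zero_sigma: "(\<integral>x. indicator A x * D x \<partial>M) = 0" if "A \<in> sigma_sets (space M) ?P" for A
  proof -
    have "Int_stable ?P"
    proof (rule Int_stableI)
      fix s t assume "s \<in> ?P" "t \<in> ?P"
      then obtain a b c d where "s = a \<inter> b" "t = c \<inter> d"
        "a \<in> sets G" "b \<in> sets H" "c \<in> sets G" "d \<in> sets H" by blast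
      then have "s \<inter> t = (a \<inter> c) \<inter> (b \<inter> d)" "a \<inter> c \<in> sets G" "b \<inter> d \<in> sets H"
        by auto
      then show "s \<inter> t \<in> ?P" by blast
    qed
    moreover have "?P \<subseteq> Pow (space M)"
      using P_M sets.space_closed by blast
    ultimately show ?thesis
      using that
    proof (induction rule: sigma_sets_induct_disjoint)
      case (basic A)
      then obtain a b where ab: "A = a \<inter> b" "a \<in> sets G" "b \<in> sets H" by blast
      have a_M: "a \<in> sets M" and b_M: "b \<in> sets M" and a_F: "a \<in> sets F"
        using ab G H GF by (auto simp: subalgebra_def)
      let ?S = "\<lambda>x. indicator a x * D x" and ?T = "indicator b :: 'a \<Rightarrow> real"
      have S: "?S \<in> borel_measurable F"
        using D_F a_F by simp
      have T: "?T \<in> borel_measurable H"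
        using ab by simp
      have "indep_set (sigma_sets (space M) {?S -` B \<inter> space M |B. B \<in> sets borel})
          (sigma_sets (space M) {?T -` B \<inter> space M |B. B \<in> sets borel})"
        unfolding indep_set_def
      proof (rule indep_sets_mono_sets[OF indep[unfolded indep_set_def]])
        have "sigma_sets (space F) {?S -` B \<inter> space F |B. B \<in> sets borel} \<subseteq> sets F"
          using measurable_sets[OF S] by (intro sets.sigma_sets_subset) blast
        moreover have "sigma_sets (space H) {?T -` B \<inter> space H |B. B \<in> sets borel} \<subseteq> sets H"
          using measurable_sets[OF T] by (intro sets.sigma_sets_subset) blast
        moreover have "space F = space M" "space H = space M"
          using F H by (simp_all add: subalgebra_def)
        ultimately show "case_bool (sigma_sets (space M) {?S -` B \<inter> space M |B. B \<in> sets borel})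
            (sigma_sets (space M) {?T -` B \<inter> space M |B. B \<in> sets borel}) i
          \<subseteq> case_bool (sets F) (sets H) i" for i
          by (simp split: bool.split)
      qed
      then have "indep_var borel ?S borel ?T"
        unfolding indep_var_eq
        using S T measurable_from_subalg[OF F] measurable_from_subalg[OF H] by blast
      then have "(\<integral>x. ?S x * ?T x \<partial>M) = (\<integral>x. ?S x \<partial>M) * (\<integral>x. ?T x \<partial>M)"
        using int_ind[OF a_M int_D] b_M by (intro indep_var_lebesgue_integral) (auto simp: less_top[symmetric])
      then show ?case
        using zero[OF ab(2)] by (simp add: ab(1) indicator_inter_arith mult_ac)
    next
      case (compl A)
      have "A \<in> sets M" using compl sigma_M by blast
      have "(\<integral>x. indicator (space M - A) x * D x \<partial>M) = (\<integral>x. D x - indicator A x * D x \<partial>M)"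
        by (intro Bochner_Integration.integral_cong) (auto simp: indicator_def)
      also have "\<dots> = (\<integral>x. indicator (space M) x * D x \<partial>M) - (\<integral>x. indicator A x * D x \<partial>M)"
        using int_D int_ind[OF \<open>A \<in> sets M\<close> int_D] 
        by (subst Bochner_Integration.integral_diff) (auto intro!: Bochner_Integration.integral_cong)
      also have "\<dots> = 0"
        using compl zero[of "space M"] G sets.top[of G] by (simp add: subalgebra_def)
      finally show ?case .
    next
      case (union A)
      have A_M: "A i \<in> sets M" for i
        using union sigma_M by blast
      have "(LINT x:(\<Union>i. A i)|M. D x) = (\<Sum>i. (LINT x:(A i)|M. D x))"
        using A_M union(1) int_ind[OF _ int_D, of "\<Union>i. A i"]
        by (intro lebesgue_integral_countable_add)
           (auto simp: disjoint_family_on_def set_integrable_def)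
      then show ?case
        using union by (simp add: set_lebesgue_integral_def)
    qed simp
  qed
  show ?thesis
  proof (rule K.real_cond_exp_charact)
    fix A assume "A \<in> sets K"
    then have A: "A \<in> sigma_sets (space M) ?P" "A \<in> sets M"
      using gen K by (auto simp: subalgebra_def)
    have "(\<integral>x. indicator A x * Z x - indicator A x * real_cond_exp M G Z x \<partial>M) = 0"
      using zero_sigma[OF A(1)] by (simp add: D_def right_diff_distrib)
    then show "(\<integral>x\<in>A. Z x \<partial>M) = (\<integral>x\<in>A. real_cond_exp M G Z x \<partial>M)"
      using int_ind[OF A(2) Z(1)] int_ind[OF A(2) int_R]
      by (simp add: set_lebesgue_integral_def)
  qed (use Z int_R measurable_from_subalg[OF GK borel_measurable_cond_exp] in auto)
qed

section \<open>The sigma-algebra generated by a subvector\<close>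

definition information ::
  "'a measure \<Rightarrow> ('i \<Rightarrow> 'b measure) \<Rightarrow> ('i \<Rightarrow> 'a \<Rightarrow> 'b) \<Rightarrow> 'i set \<Rightarrow> 'a measure" where
  "information M E X u = vimage_algebra (space M) (subvec X u) (Pi\<^sub>M u E)"

lemma cond_exp_given_eq: "cond_exp_given M E X u Z = real_cond_exp M (information M E X u) Z"
  by (simp add: cond_exp_given_def information_def)

lemma space_information [simp]: "space (information M E X u) = space M"
  by (simp add: information_def)

lemma sets_information_least:
  assumes "space N = space M" and "\<And>i. i \<in> u \<Longrightarrow> X i \<in> measurable N (E i)"
  shows "sets (information M E X u) \<subseteq> sets N"
  unfolding information_def
proof (rule sets_image_in_sets[OF assms(1)])
  show "subvec X u \<in> measurable N (Pi\<^sub>M u E)"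
    unfolding subvec_def[abs_def] using assms(2) by (rule measurable_restrict)
qed

lemma subvec_measurable_information:
  assumes "\<And>i. i \<in> u \<Longrightarrow> X i \<in> measurable M (E i)"
  shows "subvec X u \<in> measurable (information M E X u) (Pi\<^sub>M u E)"
  unfolding information_def
proof (rule measurable_vimage_algebra1)
  have "subvec X u \<in> measurable M (Pi\<^sub>M u E)"
    unfolding subvec_def[abs_def] using assms by (rule measurable_restrict)
  then show "subvec X u \<in> space M \<rightarrow> space (Pi\<^sub>M u E)"
    by (auto dest: measurable_space)
qed

lemma component_measurable_information:
  assumes "\<And>i. i \<in> u \<Longrightarrow> X i \<in> measurable M (E i)" and i: "i \<in> u"
  shows "X i \<in> measurable (information M E X u) (E i)"
proof -
  have "(\<lambda>\<omega>. subvec X u \<omega> i) \<in> measurable (information M E X u) (E i)"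
    using subvec_measurable_information[OF assms(1)] measurable_component_singleton[OF i]
    by (rule measurable_compose)
  then show ?thesis
    using i by (simp add: subvec_def)
qed

lemma subalgebra_information:
  assumes "\<And>i. i \<in> u \<Longrightarrow> X i \<in> measurable M (E i)"
  shows "subalgebra M (information M E X u)"
  unfolding subalgebra_def using sets_information_least[of M M] assms by auto

lemma information_mono:
  assumes "\<And>i. i \<in> v \<Longrightarrow> X i \<in> measurable M (E i)" "u \<subseteq> v"
  shows "subalgebra (information M E X v) (information M E X u)"
proof -
  have "X i \<in> measurable (information M E X v) (E i)" if "i \<in> u" for i
    using assms that by (intro component_measurable_information) auto
  then show ?thesis
    using sets_information_least[of "information M E X v" M u X E] by (simp add: subalgebra_def)
qed

text \<open>A vector of groups carries the same information as the concatenated subvector, since each group is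
  measurable from its members and each member is a coordinate of its group. All conditioning on
  groups can therefore be treated as conditioning on the individual variables.\<close>

lemma sets_information_groups:
  assumes X: "\<And>i. i \<in> (\<Union>j\<in>w. C j) \<Longrightarrow> X i \<in> measurable M (E i)"
  shows "sets (information M (\<lambda>j. Pi\<^sub>M (C j) E) (\<lambda>j. subvec X (C j)) w) =
    sets (information M E X (\<Union>j\<in>w. C j))" (is "sets ?G = sets ?I")
proof (rule antisym)
  show "sets ?G \<subseteq> sets ?I"
  proof (rule sets_information_least)
    fix j assume "j \<in> w"
    then show "subvec X (C j) \<in> measurable ?I (Pi\<^sub>M (C j) E)"
      unfolding subvec_def[abs_def]
      by (intro measurable_restrict component_measurable_information X) auto
  qed simp
  have group: "subvec X (C j) \<in> measurable ?G (Pi\<^sub>M (C j) E)" if "j \<in> w" for j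
  proof (rule component_measurable_information[OF _ that])
    fix j assume "j \<in> w"
    then show "subvec X (C j) \<in> measurable M (Pi\<^sub>M (C j) E)"
      unfolding subvec_def[abs_def] by (intro measurable_restrict X) auto
  qed
  show "sets ?I \<subseteq> sets ?G"
  proof (rule sets_information_least)
    fix i assume "i \<in> (\<Union>j\<in>w. C j)"
    then obtain j where j: "j \<in> w" "i \<in> C j" by blast
    have "(\<lambda>\<omega>. subvec X (C j) \<omega> i) \<in> measurable ?G (E i)"
      using group[OF j(1)] measurable_component_singleton[OF j(2)] by (rule measurable_compose)
    then show "X i \<in> measurable ?G (E i)"
      using j by (simp add: subvec_def)
  qed simp
qed

text \<open>Splitting \<open>v\<close> along \<open>c\<close> provides the generating intersections that \<open>real_cond_exp_join_indep\<close>
  asks for. The second factor may come from any larger \<open>H\<close>; in the application \<open>H\<close> belongs to whole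
  groups, for which independence is known.\<close>

lemma sets_information_subset_join:
  assumes X: "\<And>i. i \<in> v \<Longrightarrow> X i \<in> measurable M (E i)"
    and H: "subalgebra M H" "subalgebra H (information M E X (v - c))"
  shows "sets (information M E X v) \<subseteq>
    sigma_sets (space M) {a \<inter> b | a b. a \<in> sets (information M E X (v \<inter> c)) \<and> b \<in> sets H}"
    (is "_ \<subseteq> sigma_sets _ ?P")
proof -
  let ?G = "information M E X (v \<inter> c)"
  have G: "subalgebra M ?G"
    using X by (intro subalgebra_information) auto
  have P: "?P \<subseteq> Pow (space M)"
    using G H sets.space_closed[of M] by (auto simp: subalgebra_def)
  define N where "N = sigma (space M) ?P"
  have N: "space N = space M" "sets N = sigma_sets (space M) ?P"
    using P by (simp_all add: N_def)
  \<comment> \<open>Intersecting with the whole space shows that \<open>N\<close> contains each of the two sigma-algebras.\<close>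
  have "sets ?G \<subseteq> sets N"
  proof
    fix a assume a: "a \<in> sets ?G"
    have "space M \<in> sets H"
      using H(1) sets.top[of H] by (simp add: subalgebra_def)
    moreover have "a = a \<inter> space M"
      using a sets.sets_into_space[of a ?G] by auto
    ultimately have "a \<in> ?P" using a by blast
    then show "a \<in> sets N" using N by auto
  qed
  moreover have "sets (information M E X (v - c)) \<subseteq> sets N"
  proof
    fix b assume "b \<in> sets (information M E X (v - c))"
    then have b: "b \<in> sets H" using H by (auto simp: subalgebra_def)
    have "b = space M \<inter> b"
      using b H sets.sets_into_space[of b H] by (auto simp: subalgebra_def)
    moreover have "space M \<in> sets ?G"
      using sets.top[of ?G] by simp
    ultimately have "b \<in> ?P" using b by blast
    then show "b \<in> sets N" using N by auto
  qed
  moreover have "X i \<in> measurable ?G (E i)" if "i \<in> v \<inter> c" for i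
    using X that by (intro component_measurable_information) auto
  moreover have "X i \<in> measurable (information M E X (v - c)) (E i)" if "i \<in> v - c" for i
    using X that by (intro component_measurable_information) auto
  ultimately have "X i \<in> measurable N (E i)" if "i \<in> v" for i
    using that N(1) measurable_mono[of "E i" "E i" ?G N]
      measurable_mono[of "E i" "E i" "information M E X (v - c)" N]
    by (cases "i \<in> c") auto
  then show ?thesis
    using sets_information_least[of N M v X E] N by simp
qed

lemma (in prob_space) indep_information:
  assumes indep: "indep_vars E X J" and w: "w \<inter> w' = {}" "w \<subseteq> J" "w' \<subseteq> J"
  shows "indep_set (sets (information M E X w)) (sets (information M E X w'))"
  using indep_var_restrict[OF indep w]
  by (simp add: indep_var_eq information_def sets_vimage_algebra subvec_def[abs_def])

section \<open>Projections of the Hoeffding components\<close>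

text \<open>The Hoeffding decomposition with the components \<open>Z w\<close> regarded as random variables on the
  underlying space, and with all conditioning expressed through the individual inputs \<open>X\<close>.\<close>

locale grouped_decomposition = prob_space M
  for M :: "'a measure" +
  fixes E :: "'i \<Rightarrow> 'b measure" and X :: "'i \<Rightarrow> 'a \<Rightarrow> 'b"
    and J :: "'j set" and C :: "'j \<Rightarrow> 'i set"
    and Y :: "'a \<Rightarrow> real" and Z :: "'j set \<Rightarrow> 'a \<Rightarrow> real"
  assumes finite_J: "finite J"
    and finite_C: "\<And>j. j \<in> J \<Longrightarrow> finite (C j)"
    and X_measurable: "\<And>i. i \<in> (\<Union>j\<in>J. C j) \<Longrightarrow> X i \<in> measurable M (E i)"
    and indep_groups: "indep_vars (\<lambda>j. Pi\<^sub>M (C j) E) (\<lambda>j. subvec X (C j)) J"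
    and Y_measurable: "Y \<in> borel_measurable M"
    and Z_measurable_information:
      "\<And>w. w \<subseteq> J \<Longrightarrow> Z w \<in> borel_measurable (information M E X (\<Union>j\<in>w. C j))"
    and Z_square_integrable: "\<And>w. w \<subseteq> J \<Longrightarrow> integrable M (\<lambda>\<omega>. (Z w \<omega>)\<^sup>2)"
    and Z_cond_exp_eq_0: "\<And>w z. w \<subseteq> J \<Longrightarrow> z \<subseteq> J \<Longrightarrow> \<not> w \<subseteq> z \<Longrightarrow>
      AE \<omega> in M. real_cond_exp M (information M E X (\<Union>j\<in>z. C j)) (Z w) \<omega> = 0"
    and Y_eq_sum: "AE \<omega> in M. Y \<omega> = (\<Sum>w\<in>Pow J. Z w \<omega>)"
begin

abbreviation members :: "'j set \<Rightarrow> 'i set" where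
  "members w \<equiv> (\<Union>j\<in>w. C j)"

abbreviation projection :: "'i set \<Rightarrow> 'j set \<Rightarrow> 'a \<Rightarrow> real" where
  "projection v w \<equiv> real_cond_exp M (information M E X v) (Z w)"

lemma information_subalgebra:
  "v \<subseteq> members J \<Longrightarrow> finite_measure_subalgebra M (information M E X v)"
  by (intro finite_measure_subalgebraI subalgebra_information X_measurable) auto

lemma information_subalgebra_mono:
  assumes "u \<subseteq> v" "v \<subseteq> members J"
  shows "subalgebra (information M E X v) (information M E X u)"
  using assms by (intro information_mono X_measurable) auto

lemma Z_measurable:
  assumes "w \<subseteq> J"
  shows "Z w \<in> borel_measurable M"
proof (rule measurable_from_subalg)
  show "subalgebra M (information M E X (members w))"
    using assms by (intro subalgebra_information X_measurable) auto
qed (rule Z_measurable_information[OF assms])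

lemma Z_integrable: "w \<subseteq> J \<Longrightarrow> integrable M (Z w)"
  by (rule square_integrable_imp_integrable[OF Z_measurable Z_square_integrable])

lemma projection_square_integrable:
  assumes "v \<subseteq> members J" "w \<subseteq> J"
  shows "integrable M (\<lambda>\<omega>. (projection v w \<omega>)\<^sup>2)"
  by (rule finite_measure_subalgebra.real_cond_exp_square_integrable[OF
        information_subalgebra[OF assms(1)] Z_measurable[OF assms(2)] Z_square_integrable[OF assms(2)]])

text \<open>The inputs of \<open>v\<close> outside \<open>members w\<close> belong to the groups in \<open>J - w\<close>, which are jointly independent
  of the groups in \<open>w\<close>; they carry no information about \<open>Z w\<close>. Note that inputs within one group may be
  dependent, so inputs of \<open>v\<close> inside \<open>members w\<close> cannot be dropped.\<close>

lemma projection_eq_on_members: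
  assumes v: "v \<subseteq> members J" and w: "w \<subseteq> J"
  shows "AE \<omega> in M. projection v w \<omega> = projection (v \<inter> members w) w \<omega>"
proof (rule real_cond_exp_join_indep)
  let ?F = "information M E X (members w)" and ?H = "information M E X (members (J - w))"
  have w_J: "members w \<subseteq> members J" and c_J: "members (J - w) \<subseteq> members J"
    using w by auto
  show "subalgebra M ?F" "subalgebra M ?H" "subalgebra M (information M E X v)"
    using information_subalgebra[OF w_J] information_subalgebra[OF c_J] information_subalgebra[OF v]
    by (simp_all add: finite_measure_subalgebra_def finite_measure_subalgebra_axioms_def)
  show "subalgebra ?F (information M E X (v \<inter> members w))"
    using w_J by (intro information_subalgebra_mono) auto
  show "subalgebra (information M E X v) (information M E X (v \<inter> members w))"
    using v by (intro information_subalgebra_mono) auto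
  have "v - members w \<subseteq> members (J - w)"
    using v by blast
  then have "subalgebra ?H (information M E X (v - members w))"
    using c_J by (rule information_subalgebra_mono)
  then show "sets (information M E X v) \<subseteq> sigma_sets (space M)
      {a \<inter> b | a b. a \<in> sets (information M E X (v \<inter> members w)) \<and> b \<in> sets ?H}"
    using v \<open>subalgebra M ?H\<close> by (intro sets_information_subset_join X_measurable) auto
  have "sets (information M (\<lambda>j. Pi\<^sub>M (C j) E) (\<lambda>j. subvec X (C j)) z) =
      sets (information M E X (members z))" if "z \<subseteq> J" for z
    using that by (intro sets_information_groups X_measurable) auto
  from this[of w] this[of "J - w"] show "indep_set (sets ?F) (sets ?H)"
    using indep_information[OF indep_groups, of w "J - w"] w by simp
  show "integrable M (Z w)" "Z w \<in> borel_measurable ?F"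
    using w Z_integrable Z_measurable_information by auto
qed

text \<open>Both conditional expectations, given \<open>X v\<close> and given the groups in \<open>z\<close>, preserve the mean, and the
  second one vanishes.\<close>

lemma projection_expectation_eq_0:
  assumes "w \<subseteq> J" "z \<subseteq> J" "\<not> w \<subseteq> z"
    and v: "v \<subseteq> members J"
  shows "expectation (projection v w) = 0"
proof -
  have z: "members z \<subseteq> members J" using assms by auto
  interpret V: finite_measure_subalgebra M "information M E X v"
    by (rule information_subalgebra[OF v])
  interpret F: finite_measure_subalgebra M "information M E X (members z)"
    by (rule information_subalgebra[OF z])
  have "expectation (projection v w) = expectation (Z w)"
    using assms by (intro V.real_cond_exp_int Z_integrable)
  also have "\<dots> = expectation (projection (members z) w)"
    using assms by (intro F.real_cond_exp_int(2)[symmetric] Z_integrable)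
  also have "\<dots> = 0"
    using Z_cond_exp_eq_0[OF assms(1-3)] by (intro integral_eq_zero_AE)
  finally show ?thesis .
qed

text \<open>One of the two projections under the expectation may be undone, because the other is already
  measurable with respect to \<open>X v\<close>. Of two distinct sets of groups, let \<open>z\<close> be one that is not contained
  in the other, \<open>y\<close>; then the projection of \<open>Z y\<close> is measurable with respect to the groups in \<open>y\<close>, given
  which \<open>Z z\<close> has conditional expectation zero. So both sides of the equation are zero.\<close>

lemma projections_uncorrelated:
  assumes v: "v \<subseteq> members J" and w: "w \<subseteq> J" "w' \<subseteq> J" "w \<noteq> w'"
  shows "expectation (\<lambda>\<omega>. projection v w \<omega> * projection v w' \<omega>) =
    expectation (projection v w) * expectation (projection v w')"
proof -
  interpret V: finite_measure_subalgebra M "information M E X v"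
    by (rule information_subalgebra[OF v])
  have *: "expectation (\<lambda>\<omega>. projection v y \<omega> * projection v z \<omega>) =
      expectation (projection v y) * expectation (projection v z)"
    if y: "y \<subseteq> J" and z: "z \<subseteq> J" and nle: "\<not> z \<subseteq> y" for y z
  proof -
    let ?F = "information M E X (members y)"
    let ?R = "projection (v \<inter> members y) y"
    have y_J: "members y \<subseteq> members J" using y by auto
    interpret F: finite_measure_subalgebra M ?F
      by (rule information_subalgebra[OF y_J])
    have R: "AE \<omega> in M. projection v y \<omega> = ?R \<omega>"
      using v y by (rule projection_eq_on_members)
    have R_F: "?R \<in> borel_measurable ?F"
      using information_subalgebra_mono[of "v \<inter> members y" "members y"] y_J
      by (intro measurable_from_subalg[OF _ borel_measurable_cond_exp]) auto
    have "v \<inter> members y \<subseteq> members J"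
      using v by blast
    then have int: "integrable M (\<lambda>\<omega>. f \<omega> * Z z \<omega>)" if "f \<in> {projection v y, ?R}" for f
      using that v y z Z_measurable Z_square_integrable projection_square_integrable
      by (intro integrable_mult_of_squares) auto
    \<comment> \<open>Remove the projection of \<open>Z z\<close>, view the other factor as a function of the groups in \<open>y\<close>, and
      project \<open>Z z\<close> onto these groups instead.\<close>
    have "expectation (\<lambda>\<omega>. projection v y \<omega> * projection v z \<omega>) =
        expectation (\<lambda>\<omega>. projection v y \<omega> * Z z \<omega>)"
      using int Z_measurable z by (intro V.real_cond_exp_intg) auto
    also have "\<dots> = expectation (\<lambda>\<omega>. ?R \<omega> * Z z \<omega>)"
      using R Z_measurable z by (intro integral_cong_AE) auto
    also have "\<dots> = expectation (\<lambda>\<omega>. ?R \<omega> * projection (members y) z \<omega>)"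
      using int Z_measurable z R_F by (intro F.real_cond_exp_intg(2)[symmetric]) auto
    also have "\<dots> = 0"
      using Z_cond_exp_eq_0[OF z y nle] by (intro integral_eq_zero_AE) auto
    finally show ?thesis
      using projection_expectation_eq_0[OF z y nle v] by simp
  qed
  show ?thesis
  proof (cases "w' \<subseteq> w")
    case True
    then have "\<not> w \<subseteq> w'" using w by blast
    from *[OF w(2,1) this] show ?thesis by (simp add: mult.commute)
  next
    case False
    from *[OF w(1,2) this] show ?thesis .
  qed
qed

lemma explained_variance_eq_sum:
  assumes v: "v \<subseteq> members J"
  shows "explained_variance M E X Y v = (\<Sum>w\<in>Pow J. explained_variance M E X (Z w) v)"
proof -
  interpret V: finite_measure_subalgebra M "information M E X v"
    by (rule information_subalgebra[OF v])
  have "AE \<omega> in M. real_cond_exp M (information M E X v) Y \<omega> =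
      real_cond_exp M (information M E X v) (\<lambda>\<omega>. \<Sum>w\<in>Pow J. Z w \<omega>) \<omega>"
    using Y_eq_sum Y_measurable Z_measurable by (intro V.real_cond_exp_cong) auto
  moreover have "AE \<omega> in M. real_cond_exp M (information M E X v) (\<lambda>\<omega>. \<Sum>w\<in>Pow J. Z w \<omega>) \<omega> =
      (\<Sum>w\<in>Pow J. projection v w \<omega>)"
    using Z_integrable by (intro V.real_cond_exp_sum_finite) auto
  ultimately have "AE \<omega> in M. real_cond_exp M (information M E X v) Y \<omega> =
      (\<Sum>w\<in>Pow J. projection v w \<omega>)"
    by (rule eventually_elim2) simp
  then have "variance (real_cond_exp M (information M E X v) Y) =
      variance (\<lambda>\<omega>. \<Sum>w\<in>Pow J. projection v w \<omega>)"
    by (intro variance_cong_AE) auto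
  also have "\<dots> = (\<Sum>w\<in>Pow J. variance (projection v w))"
    using finite_J v projection_square_integrable projections_uncorrelated
    by (intro variance_sum_uncorrelated) auto
  finally show ?thesis
    by (simp add: explained_variance_def cond_exp_given_eq)
qed

lemma explained_variance_members:
  assumes w: "w \<subseteq> J" and z: "z \<subseteq> J"
  shows "explained_variance M E X (Z w) (members z) = (if w \<subseteq> z then variance (Z w) else 0)"
proof (cases "w \<subseteq> z")
  case True
  have z_J: "members z \<subseteq> members J" using z by auto
  interpret F: finite_measure_subalgebra M "information M E X (members z)"
    by (rule information_subalgebra[OF z_J])
  have "members w \<subseteq> members z"
    using True by auto
  then have "Z w \<in> borel_measurable (information M E X (members z))"
    using Z_measurable_information[OF w]
    by (rule measurable_from_subalg[OF information_subalgebra_mono[OF _ z_J]])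
  then have "AE \<omega> in M. projection (members z) w \<omega> = Z w \<omega>"
    using Z_integrable[OF w] by (intro F.real_cond_exp_F_meas)
  then have "variance (projection (members z) w) = variance (Z w)"
    using Z_measurable[OF w] by (intro variance_cong_AE) auto
  then show ?thesis
    using True by (simp add: explained_variance_def cond_exp_given_eq)
next
  case False
  then have "variance (projection (members z) w) = variance (\<lambda>_. 0)"
    using Z_cond_exp_eq_0[OF w z] by (intro variance_cong_AE) auto
  then show ?thesis
    using False by (simp add: explained_variance_def cond_exp_given_eq)
qed

section \<open>Sobol indices\<close>

text \<open>The variance explained by the groups in \<open>z\<close> is the sum of \<open>variance (Z y)\<close> over \<open>y \<subseteq> z\<close>: components
  inside \<open>z\<close> are their own projections, the others project to zero. Moebius inversion then isolates
  \<open>variance (Z w)\<close>.\<close>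

lemma sobol_index_groups:
  assumes w: "w \<subseteq> J"
  shows "sobol_index M (\<lambda>j. Pi\<^sub>M (C j) E) (\<lambda>j. subvec X (C j)) Y w = variance (Z w) / variance Y"
proof -
  have group: "explained_variance M (\<lambda>j. Pi\<^sub>M (C j) E) (\<lambda>j. subvec X (C j)) Y z =
      (\<Sum>y\<in>Pow z. variance (Z y))" if z: "z \<in> Pow w" for z
  proof -
    have z_J: "z \<subseteq> J" using z w by auto
    have "real_cond_exp M (information M (\<lambda>j. Pi\<^sub>M (C j) E) (\<lambda>j. subvec X (C j)) z) Y =
        real_cond_exp M (information M E X (members z)) Y"
      using z_J by (intro real_cond_exp_cong_sets sets_information_groups X_measurable) auto
    then have "explained_variance M (\<lambda>j. Pi\<^sub>M (C j) E) (\<lambda>j. subvec X (C j)) Y z =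
        explained_variance M E X Y (members z)"
      unfolding explained_variance_def cond_exp_given_eq by simp
    also have "\<dots> = (\<Sum>y\<in>Pow J. if y \<subseteq> z then variance (Z y) else 0)"
      using z_J by (subst explained_variance_eq_sum)
        (auto intro!: sum.cong explained_variance_members)
    also have "\<dots> = (\<Sum>y\<in>Pow z. variance (Z y))"
      using z_J finite_J by (intro sum.mono_neutral_cong_right) auto
    finally show ?thesis .
  qed
  have "finite w" using w finite_J by (rule finite_subset)
  have "(\<Sum>z\<in>Pow w. (-1) ^ (card w - card z) *
        explained_variance M (\<lambda>j. Pi\<^sub>M (C j) E) (\<lambda>j. subvec X (C j)) Y z) =
      (\<Sum>z\<in>Pow w. (-1) ^ (card w - card z) * (\<Sum>y\<in>Pow z. variance (Z y)))"
    by (intro sum.cong refl) (simp only: group)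
  also have "\<dots> = variance (Z w)"
    using \<open>finite w\<close> by (rule alternating_sum_of_subset_sums)
  finally show ?thesis
    by (simp add: sobol_index_def)
qed

text \<open>\<open>D w\<close> is the Sobol index of \<open>Z w\<close> before normalisation. Unlike the index it is meaningful for a
  component of variance zero, where it vanishes, in accordance with the convention for the product.\<close>

theorem sobol_index_eq_sum_over_groups:
  assumes u: "u \<subseteq> members J"
  shows "sobol_index M E X Y u = (\<Sum>w | w \<subseteq> J \<and> u \<subseteq> members w.
    sobol_index M (\<lambda>j. Pi\<^sub>M (C j) E) (\<lambda>j. subvec X (C j)) Y w * sobol_index M E X (Z w) u)"
proof -
  define D where "D w = (\<Sum>v\<in>Pow u. (-1) ^ (card u - card v) * explained_variance M E X (Z w) v)" for w
  have fin: "finite u"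
  proof (rule finite_subset[OF u])
    show "finite (members J)"
      using finite_J finite_C by (rule finite_UN_I)
  qed
  have D_eq_0: "D w = 0" if w: "w \<subseteq> J" and nle: "\<not> u \<subseteq> members w" for w
  proof -
    obtain i where i: "i \<in> u" "i \<notin> members w" using nle by blast
    have "explained_variance M E X (Z w) (insert i v) = explained_variance M E X (Z w) v"
      if "v \<subseteq> u - {i}" for v
    proof -
      have v: "insert i v \<subseteq> members J" "v \<subseteq> members J" using that u i by auto
      have "insert i v \<inter> members w = v \<inter> members w" using i by auto
      then have "AE \<omega> in M. projection (insert i v) w \<omega> = projection v w \<omega>"
        using projection_eq_on_members[OF v(1) w] projection_eq_on_members[OF v(2) w] by auto
      then show ?thesis
        unfolding explained_variance_def cond_exp_given_eq by (intro variance_cong_AE) auto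
    qed
    then show ?thesis
      unfolding D_def using fin i by (intro alternating_sum_eq_0) auto
  qed
  have D_eq: "D w = variance (Z w) * sobol_index M E X (Z w) u" if w: "w \<subseteq> J" for w
  proof (cases "variance (Z w) = 0")
    case True
    have "explained_variance M E X (Z w) v = 0" if "v \<in> Pow u" for v
      unfolding explained_variance_def cond_exp_given_eq
      using that u w True Z_measurable Z_square_integrable
      by (intro variance_cond_exp_eq_0 subalgebra_information X_measurable) auto
    then show ?thesis
      using True by (simp add: D_def)
  qed (simp add: D_def sobol_index_def)
  have "sobol_index M E X Y u = 1 / variance Y *
      (\<Sum>v\<in>Pow u. \<Sum>w\<in>Pow J. (-1) ^ (card u - card v) * explained_variance M E X (Z w) v)"
    using u unfolding sobol_index_def
    by (intro arg_cong2[where f = "(*)"] sum.cong refl)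
      (subst explained_variance_eq_sum, auto simp: sum_distrib_left)
  also have "\<dots> = 1 / variance Y * (\<Sum>w\<in>Pow J. D w)"
    unfolding D_def by (subst sum.swap) simp
  also have "(\<Sum>w\<in>Pow J. D w) = (\<Sum>w | w \<subseteq> J \<and> u \<subseteq> members w. D w)"
    using finite_J D_eq_0 by (intro sum.mono_neutral_right) auto
  also have "1 / variance Y * \<dots> = (\<Sum>w | w \<subseteq> J \<and> u \<subseteq> members w.
      sobol_index M (\<lambda>j. Pi\<^sub>M (C j) E) (\<lambda>j. subvec X (C j)) Y w * sobol_index M E X (Z w) u)"
    unfolding sum_distrib_left by (intro sum.cong) (auto simp: D_eq sobol_index_groups)
  finally show ?thesis .
qed

end

lemma regroup_subvec:
  assumes disj: "disjoint_family_on C J" and cover: "(\<Union>j\<in>J. C j) = I"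
  shows "regroup I J C f (subvec (\<lambda>j. subvec X (C j)) J \<omega>) = f (subvec X I \<omega>)"
proof -
  have "subvec (\<lambda>j. subvec X (C j)) J \<omega> (THE j. j \<in> J \<and> i \<in> C j) i = X i \<omega>" if "i \<in> I" for i
  proof -
    from that obtain j where j: "j \<in> J" "i \<in> C j"
      unfolding cover[symmetric] by blast
    have "(THE j. j \<in> J \<and> i \<in> C j) = j"
    proof (rule the_equality)
      show "j' = j" if "j' \<in> J \<and> i \<in> C j'" for j'
        using that j disjoint_family_onD[OF disj, of j' j] by blast
    qed (use j in blast)
    then show ?thesis
      using j by (simp add: subvec_def)
  qed
  then show ?thesis
    unfolding regroup_def subvec_def[of X I] by (intro arg_cong[of _ _ f] restrict_ext)
qed

text \<open>It remains to recognise the data of the theorem as a \<open>grouped_decomposition\<close>: the function of the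
  groups evaluates to \<open>Y\<close>, and the components, being functions of the group vector, are measurable
  with respect to the members of their groups.\<close>

theorem proposition2:
  fixes M :: "'a measure"
    and E :: "nat \<Rightarrow> 'b measure"
    and X :: "nat \<Rightarrow> 'a \<Rightarrow> 'b"
    and f :: "(nat \<Rightarrow> 'b) \<Rightarrow> real"
    and Y :: "'a \<Rightarrow> real"
    and p k :: nat
    and C :: "nat \<Rightarrow> nat set"
    and A :: "nat \<Rightarrow> 'a \<Rightarrow> nat \<Rightarrow> 'b"
    and g :: "(nat \<Rightarrow> nat \<Rightarrow> 'b) \<Rightarrow> real"
    and gw :: "nat set \<Rightarrow> (nat \<Rightarrow> nat \<Rightarrow> 'b) \<Rightarrow> real"
    and u :: "nat set"
  assumes "prob_space M"
    and X: "\<And>i. i \<in> {1..p} \<Longrightarrow> X i \<in> measurable M (E i)"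
    and f: "f \<in> borel_measurable (Pi\<^sub>M {1..p} E)"
    and Y: "Y = (\<lambda>\<omega>. f (subvec X {1..p} \<omega>))"
    and "integrable M (\<lambda>\<omega>. (Y \<omega>)\<^sup>2)"
    and "prob_space.variance M Y \<noteq> 0"
    and C_nonempty: "\<And>j. j \<in> {1..k} \<Longrightarrow> C j \<noteq> {}"
    and C_disjoint: "disjoint_family_on C {1..k}"
    and C_cover: "(\<Union>j\<in>{1..k}. C j) = {1..p}"
    and A: "A = (\<lambda>j. subvec X (C j))"
    and A_indep: "prob_space.indep_vars M (\<lambda>j. Pi\<^sub>M (C j) E) A {1..k}"
    and g: "g = regroup {1..p} {1..k} C f"
    and gw: "hoeffding_decomposition M {1..k} (\<lambda>j. Pi\<^sub>M (C j) E) A g gw"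
    and u: "u \<subseteq> {1..p}"
  shows "sobol_index M E X Y u =
    (\<Sum>w | w \<subseteq> {1..k} \<and> u \<subseteq> (\<Union>j\<in>w. C j).
       sobol_index M (\<lambda>j. Pi\<^sub>M (C j) E) A Y w *
       sobol_index M E X (\<lambda>\<omega>. gw w (subvec A w \<omega>)) u)"
proof -
  interpret prob_space M by fact
  have X': "X i \<in> measurable M (E i)" if "i \<in> (\<Union>j\<in>{1..k}. C j)" for i
    using that unfolding C_cover by (rule X)
  have A_z: "cond_exp_given M (\<lambda>j. Pi\<^sub>M (C j) E) A z V =
      real_cond_exp M (information M E X (\<Union>j\<in>z. C j)) V" if "z \<subseteq> {1..k}" for z and V :: "'a \<Rightarrow> real"
    unfolding cond_exp_given_eq A
    using that by (intro real_cond_exp_cong_sets sets_information_groups X') auto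
  have g_A: "g (subvec A {1..k} \<omega>) = Y \<omega>" for \<omega>
    unfolding g A Y using C_disjoint C_cover by (rule regroup_subvec)
  note components = gw[unfolded hoeffding_decomposition_def, THEN conjunct1, rule_format]
  have decomposition: "gw w \<in> borel_measurable (Pi\<^sub>M w (\<lambda>j. Pi\<^sub>M (C j) E))"
      "integrable M (\<lambda>\<omega>. (gw w (subvec A w \<omega>))\<^sup>2)"
    if "w \<subseteq> {1..k}" for w
    by (rule components[OF that, THEN conjunct1],
        rule components[OF that, THEN conjunct2, THEN conjunct1])
  interpret grouped_decomposition M E X "{1..k}" C Y "\<lambda>w \<omega>. gw w (subvec A w \<omega>)"
  proof (intro grouped_decomposition.intro grouped_decomposition_axioms.intro)
    show "prob_space M" by fact
    show "finite (C j)" if "j \<in> {1..k}" for j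
    proof (rule finite_subset)
      show "C j \<subseteq> {1..p}" unfolding C_cover[symmetric] using that by blast
    qed simp
    show "X i \<in> measurable M (E i)" if "i \<in> (\<Union>j\<in>{1..k}. C j)" for i
      using that by (rule X')
    show "indep_vars (\<lambda>j. Pi\<^sub>M (C j) E) (\<lambda>j. subvec X (C j)) {1..k}"
      using A_indep by (simp add: A)
    have "subvec X {1..p} \<in> measurable M (Pi\<^sub>M {1..p} E)"
      unfolding subvec_def[abs_def] using X by (rule measurable_restrict)
    from measurable_compose[OF this f] show "Y \<in> borel_measurable M"
      by (simp add: Y)
    show "(\<lambda>\<omega>. gw w (subvec A w \<omega>)) \<in> borel_measurable (information M E X (\<Union>j\<in>w. C j))"
      if w: "w \<subseteq> {1..k}" for w
    proof -
      have "A j \<in> measurable M (Pi\<^sub>M (C j) E)" if "j \<in> w" for j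
        unfolding A subvec_def[abs_def] using that w by (intro measurable_restrict X') auto
      from measurable_compose[OF subvec_measurable_information[of w A, OF this] decomposition(1)[OF w]]
      have "(\<lambda>\<omega>. gw w (subvec A w \<omega>)) \<in> borel_measurable (information M (\<lambda>j. Pi\<^sub>M (C j) E) A w)"
        by simp
      moreover have "sets (information M (\<lambda>j. Pi\<^sub>M (C j) E) A w) = sets (information M E X (\<Union>j\<in>w. C j))"
        unfolding A using w by (intro sets_information_groups X') auto
      ultimately show ?thesis
        using measurable_cong_sets by blast
    qed
    show "integrable M (\<lambda>\<omega>. (gw w (subvec A w \<omega>))\<^sup>2)" if "w \<subseteq> {1..k}" for w
      using that by (rule decomposition)
    show "AE \<omega> in M. real_cond_exp M (information M E X (\<Union>j\<in>z. C j)) (\<lambda>\<omega>. gw w (subvec A w \<omega>)) \<omega> = 0"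
      if w: "w \<subseteq> {1..k}" and z: "z \<subseteq> {1..k}" "\<not> w \<subseteq> z" for w z
      using components[OF w, THEN conjunct2, THEN conjunct2, rule_format, OF z]
      unfolding A_z[OF z(1)] .
    show "AE \<omega> in M. Y \<omega> = (\<Sum>w\<in>Pow {1..k}. gw w (subvec A w \<omega>))"
      using gw[unfolded hoeffding_decomposition_def, THEN conjunct2] unfolding g_A .
  qed simp
  have "u \<subseteq> members {1..k}"
    unfolding C_cover by (rule u)
  from sobol_index_eq_sum_over_groups[OF this, folded A] show ?thesis .
qed

end
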